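(* Let $F:\mathbb{R}^p\to\mathbb{R}^p$ be continuously differentiable and let $x^k$ be the iterates of the Newton-Raphson method with stepsize $1$, $$x^{k+1}=x^k-\big(DF(x^k)^\top\big)^\dagger F(x^k),$$ and let $n(x)=-(DF(x)^\top)^\dagger F(x)$. Consider the following two sets of assumptions. (I) $F$ is component-wise convex; $(DF(x)^\top)^{-1}$ exists and is element-wise positive for all $x\in\mathbb{R}^p$; and there exist $x,y\in\mathbb{R}^p$ such that $F(x)\le0\le F(y)$ element-wise. (II) There exists a unique $x^*\in\mathbb{R}^p$ such that $F(x^* )=0$, and for all $k\ge1$, $$F(x^k)\in\mathrm{Im}(DF(x^k)^\top)\qquad\text{and}\qquad\frac12\|n(x^k)\|^2\le\langle n(x^k),x^*-x^k\rangle .$$ If (I) holds, then (II) always holds. Furthermore, there exist problems for which (II) holds and (I) does not hold.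
   Context: $DF(x)=[\nabla F_1(x)\ \cdots\ \nabla F_p(x)]\in\mathbb{R}^{p\times p}$ is the transpose of the Jacobian of $F$ at $x$, so $DF(x)^\top$ is the Jacobian; $\dagger$ is the Moore-Penrose pseudoinverse; $\mathrm{Im}$ is the image (column space); $\|\cdot\|$ is the Euclidean norm. The starting point $x^0\in\mathbb{R}^p$ is arbitrary. *)

theory Defs
  imports "HOL-Analysis.Analysis"
begin

text \<open>The Moore-Penrose pseudoinverse, via the four Penrose equations. Existence and uniqueness
  are proved below, so the definite description always denotes the pseudoinverse.\<close>

definition penrose :: "real^'n^'m \<Rightarrow> real^'m^'n \<Rightarrow> bool" where
  "penrose A X \<longleftrightarrow>
     A ** X ** A = A \<and> X ** A ** X = X \<and>
     transpose (A ** X) = A ** X \<and> transpose (X ** A) = X ** A"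

definition pinv :: "real^'n^'m \<Rightarrow> real^'m^'n" where
  "pinv A = (THE X. penrose A X)"

lemma penrose_unique:
  assumes "penrose A X" "penrose A Y"
  shows "X = Y"
proof -
  note X = assms(1)[unfolded penrose_def] and Y = assms(2)[unfolded penrose_def]
  have "A ** X = (A ** Y) ** (A ** X)"
    using Y by (metis matrix_mul_assoc)
  then have "A ** X = transpose ((A ** Y) ** (A ** X))"
    using X by metis
  also have "\<dots> = A ** X ** (A ** Y)"
    using X Y by (simp add: matrix_transpose_mul)
  also have "\<dots> = A ** Y"
    using X by (metis matrix_mul_assoc)
  finally have AX: "A ** X = A ** Y" .
  have "X ** A = (X ** A) ** (Y ** A)"
    using Y by (metis matrix_mul_assoc)
  then have "X ** A = transpose ((X ** A) ** (Y ** A))"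
    using X by metis
  also have "\<dots> = Y ** A ** (X ** A)"
    using X Y by (simp add: matrix_transpose_mul)
  also have "\<dots> = Y ** A"
    using X by (metis matrix_mul_assoc)
  finally have XA: "X ** A = Y ** A" .
  show ?thesis
    using X Y AX XA by (metis matrix_mul_assoc)
qed

lemma penrose_exists:
  fixes A :: "real^'n^'m"
  shows "\<exists>X. penrose A X"
proof -
  let ?T = "transpose A"
  have sub: "subspace (range (\<lambda>x. B *v x))" for B :: "real^'k^'l"
    by (intro linear_subspace_image subspace_UNIV matrix_vector_mul_linear)
  have orth0: "transpose B *v z = 0" if "\<And>y. orthogonal z (B *v y)"
    for B :: "real^'k^'l" and z
  proof -
    have "inner (transpose B *v z) (transpose B *v z) = 0"
      using that[of "transpose B *v z"]
      by (simp add: orthogonal_def dot_lmul_matrix)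
    then show ?thesis by simp
  qed
  have ex: "\<exists>u. ?T *v (A *v (?T *v u)) = ?T *v w" for w :: "real^'m"
  proof -
    obtain y z where yz: "y \<in> range (\<lambda>x. A *v x)" "\<And>v. v \<in> range (\<lambda>x. A *v x) \<Longrightarrow> orthogonal z v"
      "w = y + z"
      using orthogonal_subspace_decomp_exists[of "range (\<lambda>x. A *v x)" w]
      by (metis sub span_eq_iff)
    then obtain x where x: "y = A *v x" by auto
    obtain a b where ab: "a \<in> range (\<lambda>x. ?T *v x)" "\<And>v. v \<in> range (\<lambda>x. ?T *v x) \<Longrightarrow> orthogonal b v"
      "x = a + b"
      using orthogonal_subspace_decomp_exists[of "range (\<lambda>x. ?T *v x)" x]
      by (metis sub span_eq_iff)
    then obtain u where u: "a = ?T *v u" by auto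
    have z0: "?T *v z = 0" by (rule orth0) (use yz in blast)
    have "transpose ?T *v b = 0" by (rule orth0) (use ab in blast)
    then have b0: "A *v b = 0" by (simp only: transpose_transpose)
    have "?T *v w = ?T *v (A *v (?T *v u)) + ?T *v (A *v b) + ?T *v z"
      by (simp only: yz(3) x ab(3) u matrix_vector_right_distrib)
    then show ?thesis using z0 b0 by (metis add.right_neutral matrix_vector_mult_0_right)
  qed
  then obtain f where f: "\<And>w :: real^'m. ?T *v (A *v (?T *v (f w))) = ?T *v w" by metis
  define U :: "real^'m^'m" where "U = (\<chi> i j. f (axis j 1) $ i)"
  have Ucol: "U *v axis j 1 = f (axis j 1)" for j
    by (simp add: U_def matrix_vector_mult_basis column_def vec_eq_iff)
  have U: "?T ** A ** ?T ** U = ?T"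
  proof -
    have "column j (?T ** A ** ?T ** U) = column j ?T" for j
      using f[of "axis j 1"]
      by (simp only: matrix_vector_mult_basis[symmetric] matrix_vector_mul_assoc[symmetric] Ucol)
    then show ?thesis by (simp add: vec_eq_iff column_def)
  qed
  define X where "X = ?T ** U"
  have TAX: "?T ** A ** X = ?T"
    using U by (simp add: X_def matrix_mul_assoc)
  have "transpose (A ** X) ** (A ** X) = transpose (A ** X)"
    using TAX by (metis matrix_mul_assoc matrix_transpose_mul)
  then have s1: "transpose (A ** X) = A ** X"
    by (metis matrix_transpose_mul transpose_transpose)
  have e1: "A ** X ** A = A"
    using TAX s1 by (metis matrix_mul_assoc matrix_transpose_mul transpose_transpose)
  have "transpose (X ** A) ** (X ** A) = transpose (X ** A)"
  proof -
    have "transpose (X ** A) = ?T ** transpose U ** A"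
      by (simp add: X_def matrix_transpose_mul matrix_mul_assoc)
    then show ?thesis using e1 by (metis matrix_mul_assoc)
  qed
  then have s2: "transpose (X ** A) = X ** A"
    by (metis matrix_transpose_mul transpose_transpose)
  have "X ** A ** ?T = ?T"
    using e1 s2 by (metis matrix_mul_assoc matrix_transpose_mul)
  then have e2: "X ** A ** X = X"
    by (metis X_def matrix_mul_assoc)
  show ?thesis using e1 e2 s1 s2 by (auto simp: penrose_def)
qed

lemma penrose_pinv: "penrose A (pinv A)"
  unfolding pinv_def by (metis penrose_exists penrose_unique theI)

definition C1 :: "(real^'n \<Rightarrow> real^'m) \<Rightarrow> bool" where
  "C1 F \<longleftrightarrow> (\<forall>x. F differentiable (at x)) \<and> continuous_on UNIV (\<lambda>x. jacobian F (at x))"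

definition DF :: "(real^'p \<Rightarrow> real^'p) \<Rightarrow> real^'p \<Rightarrow> real^'p^'p" where
  "DF F x = transpose (jacobian F (at x))"

definition newton_dir :: "(real^'p \<Rightarrow> real^'p) \<Rightarrow> real^'p \<Rightarrow> real^'p" where
  "newton_dir F x = - (pinv (transpose (DF F x)) *v F x)"

primrec newton_iter :: "(real^'p \<Rightarrow> real^'p) \<Rightarrow> real^'p \<Rightarrow> nat \<Rightarrow> real^'p" where
  "newton_iter F x0 0 = x0"
| "newton_iter F x0 (Suc k) =
     newton_iter F x0 k - pinv (transpose (DF F (newton_iter F x0 k))) *v F (newton_iter F x0 k)"

text \<open>The order on \<^typ>\<open>real^'p\<close> is the element-wise one. Element-wise positivity of a matrix is
  strict.\<close>

definition assumption_I :: "(real^'p \<Rightarrow> real^'p) \<Rightarrow> bool" where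
  "assumption_I F \<longleftrightarrow>
     (\<forall>i. convex_on UNIV (\<lambda>x. F x $ i)) \<and>
     (\<forall>x. invertible (transpose (DF F x)) \<and>
          (\<forall>i j. matrix_inv (transpose (DF F x)) $ i $ j > 0)) \<and>
     (\<exists>x y. F x \<le> 0 \<and> 0 \<le> F y)"

definition assumption_II :: "(real^'p \<Rightarrow> real^'p) \<Rightarrow> real^'p \<Rightarrow> bool" where
  "assumption_II F x0 \<longleftrightarrow>
     (\<exists>xs. F xs = 0 \<and> (\<forall>z. F z = 0 \<longrightarrow> z = xs) \<and>
        (\<forall>k\<ge>1. let xk = newton_iter F x0 k in
           F xk \<in> range (\<lambda>v. transpose (DF F xk) *v v) \<and>
           1/2 * (norm (newton_dir F xk))\<^sup>2 \<le> inner (newton_dir F xk) (xs - xk)))"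

end

theory Submission
  imports Defs
begin

text \<open>Each component of \<open>F\<close> lies above its tangents and the inverse Jacobian is monotone, so one
  Newton step from any point lands in \<open>{x. 0 \<le> F x}\<close>, and from such a point the step is \<open>\<le> 0\<close> but
  does not pass below any point where \<open>F \<le> 0\<close>. Started in \<open>{x. 0 \<le> F x}\<close>, the iterates therefore
  decrease to a zero of \<open>F\<close>; and as \<open>x\<^sup>* - x \<le> n x \<le> 0\<close>, the inequality holds even without the factor
  one half. The map \<open>x \<mapsto> -x\<close> satisfies (II) but not (I).\<close>

text \<open>Restricting \<open>f\<close> to the line through \<open>x\<close> and \<open>z\<close>
  reduces the claim to the tangent inequality for a convex function of one real variable, taken
  between the parameters 0 and 1.\<close>

lemma convex_on_UNIV_above_tangent:
  fixes f :: "'a::real_normed_vector \<Rightarrow> real"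
  assumes f: "convex_on UNIV f" and d: "(f has_derivative f') (at x)"
  shows "f x + f' (z - x) \<le> f z"
proof -
  define g where "g t = f (x + t *\<^sub>R (z - x))" for t
  have "convex_on UNIV g"
  proof (rule convex_onI)
    fix t a b :: real
    assume t: "0 < t" "t < 1"
    have "x + ((1 - t) *\<^sub>R a + t *\<^sub>R b) *\<^sub>R (z - x)
        = (1 - t) *\<^sub>R (x + a *\<^sub>R (z - x)) + t *\<^sub>R (x + b *\<^sub>R (z - x))"
      by (simp add: algebra_simps)
    then show "g ((1 - t) *\<^sub>R a + t *\<^sub>R b) \<le> (1 - t) * g a + t * g b"
      using convex_onD[OF f, of t] t by (simp add: g_def)
  qed simp
  moreover have "(g has_real_derivative f' (z - x)) (at 0)"
  proof -
    have "((\<lambda>t. x + t *\<^sub>R (z - x)) has_derivative (\<lambda>t. t *\<^sub>R (z - x))) (at 0)"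
      by (auto intro!: derivative_eq_intros)
    moreover have "(f has_derivative f') (at (x + 0 *\<^sub>R (z - x)))"
      using d by simp
    ultimately have "(g has_derivative (\<lambda>t. f' (t *\<^sub>R (z - x)))) (at 0)"
      unfolding g_def by (rule has_derivative_compose)
    then show ?thesis
      using linear_scale[OF has_derivative_linear[OF d]]
      by (simp add: has_field_derivative_def mult_commute_abs)
  qed
  ultimately have "g 1 - g 0 \<ge> f' (z - x) * (1 - 0)"
    by (intro convex_on_imp_above_tangent[of UNIV]) auto
  then show ?thesis by (simp add: g_def)
qed

lemma matrix_vector_mult_mono:
  fixes A :: "real^'n^'m"
  assumes "\<And>i j. 0 \<le> A $ i $ j" "u \<le> v"
  shows "A *v u \<le> A *v v"
  using assms
  by (auto simp: less_eq_vec_def matrix_vector_mult_def intro!: sum_mono mult_left_mono)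

text \<open>A two-sided inverse satisfies the four Penrose equations, and these have only one
  solution. With \<open>B\<close> explicit, the rule serves both \<open>matrix_inv\<close> and
  concrete inverses.\<close>

lemma pinv_eq:
  fixes A :: "real^'n^'m"
  assumes "A ** B = mat 1" "B ** A = mat 1"
  shows "pinv A = B"
  using assms penrose_pinv[of A]
  by (intro penrose_unique[of A]) (auto simp: penrose_def transpose_mat)

lemma matrix_inv_both:
  fixes A :: "real^'n^'m"
  assumes "invertible A"
  shows "A ** matrix_inv A = mat 1" "matrix_inv A ** A = mat 1"
  using someI_ex[OF assms[unfolded invertible_def]] by (auto simp: matrix_inv_def)

lemma pinv_invertible:
  fixes A :: "real^'n^'m"
  assumes "invertible A"
  shows "pinv A = matrix_inv A"
  using matrix_inv_both[OF assms] by (rule pinv_eq)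

lemma tendsto_matrix_vector_mult:
  fixes A :: "'b \<Rightarrow> real^'n^'m"
  assumes "(A \<longlongrightarrow> a) G" "(x \<longlongrightarrow> b) G"
  shows "((\<lambda>k. A k *v x k) \<longlongrightarrow> a *v b) G"
  using assms
  by (auto simp: matrix_vector_mult_def intro!: vec_tendstoI tendsto_intros)

lemma decseq_vec_bounded_convergent:
  fixes X :: "nat \<Rightarrow> real^'n"
  assumes "decseq X" "\<And>k. b \<le> X k"
  obtains L where "X \<longlonglongrightarrow> L"
proof -
  have "\<exists>l. (\<lambda>k. X k $ i) \<longlonglongrightarrow> l" for i
  proof -
    have "decseq (\<lambda>k. X k $ i)" "\<And>k. b $ i \<le> X k $ i"
      using assms by (simp_all add: monotone_on_def less_eq_vec_def)
    then show ?thesis by (metis decseq_convergent)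
  qed
  then obtain l where "\<And>i. (\<lambda>k. X k $ i) \<longlonglongrightarrow> l i" by metis
  then have "X \<longlonglongrightarrow> (\<chi> i. l i)" by (intro vec_tendstoI) simp
  then show ?thesis by (rule that)
qed

text \<open>The convex setting of (I), with the pseudoinverse already replaced by a true inverse
  \<open>B x\<close> of the Jacobian \<open>J x\<close>. The points that bracket a zero enter only
  in \<open>zero_exists\<close>.\<close>

locale monotone_newton =
  fixes F :: "real^'p \<Rightarrow> real^'p" and J B :: "real^'p \<Rightarrow> real^'p^'p"
  assumes deriv: "\<And>x. (F has_derivative (*v) (J x)) (at x)"
    and contJ: "continuous_on UNIV J"
    and conv: "\<And>i. convex_on UNIV (\<lambda>x. F x $ i)"
    and JB: "\<And>x. J x ** B x = mat 1"
    and BJ: "\<And>x. B x ** J x = mat 1"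
    and B_nonneg: "\<And>x i j. 0 \<le> B x $ i $ j"
begin

definition step :: "real^'p \<Rightarrow> real^'p" where
  "step x = x - B x *v F x"

lemma B_J_apply [simp]: "B x *v (J x *v v) = v"
  by (simp add: matrix_vector_mul_assoc BJ)

lemma J_B_apply [simp]: "J x *v (B x *v v) = v"
  by (simp add: matrix_vector_mul_assoc JB)

lemma above_tangent: "F x + J x *v (z - x) \<le> F z"
proof -
  have "((\<lambda>x. F x $ i) has_derivative (\<lambda>h. (J x *v h) $ i)) (at x)" for i
    using deriv by (rule bounded_linear.has_derivative[OF bounded_linear_vec_nth])
  from convex_on_UNIV_above_tangent[OF conv this] show ?thesis
    by (simp add: less_eq_vec_def)
qed

text \<open>The linearization of \<open>F\<close> at \<open>x\<close> vanishes at
  \<open>step x\<close>, and \<open>F\<close> lies above it.\<close>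

lemma F_step_nonneg: "0 \<le> F (step x)"
  using above_tangent[of x "step x"] by (simp add: step_def linear_neg[OF matrix_vector_mul_linear])

lemma step_le:
  assumes "0 \<le> F x"
  shows "step x \<le> x"
  using matrix_vector_mult_mono[OF B_nonneg assms, of x] by (simp add: step_def)

text \<open>The linearization at \<open>x\<close> is \<le> 0 at \<open>z\<close>; applying
  \<open>B x\<close>, which preserves the order because its entries are nonnegative, solves this
  inequality for \<open>z\<close>.\<close>

lemma le_step:
  assumes "F z \<le> 0"
  shows "z \<le> step x"
proof -
  have "F x + J x *v (z - x) \<le> 0"
    using above_tangent assms by (rule order_trans)
  from matrix_vector_mult_mono[OF B_nonneg this, of x]
  have "B x *v F x + (z - x) \<le> 0"
    by (simp add: matrix_vector_right_distrib)
  then show ?thesis by (simp add: step_def algebra_simps)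
qed

lemma zero_exists:
  assumes "F a \<le> 0" "0 \<le> F b"
  obtains z where "F z = 0"
proof -
  define X where "X k = (step ^^ k) b" for k
  have X_Suc: "X (Suc k) = step (X k)" for k by (simp add: X_def)
  have pos: "0 \<le> F (X k)" for k
    by (cases k) (auto simp: X_Suc F_step_nonneg assms(2) X_def[of 0])
  have dec: "decseq X"
    by (intro decseq_SucI) (simp add: X_Suc step_le pos)
  have "a \<le> X (Suc k)" for k using assms(1) by (simp add: X_Suc le_step)
  \<comment> \<open>Only points of the form \<open>step x\<close> are known to lie above
    \<open>a\<close>; monotonicity carries the bound back one index, so that it includes the start
    \<open>b\<close>.\<close>
  then have "a \<le> X k" for k using decseq_SucD[OF dec] by (rule order_trans)
  with dec obtain L where L: "X \<longlonglongrightarrow> L" by (rule decseq_vec_bounded_convergent)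
  \<comment> \<open>Solving the Newton equation for \<open>F (X k)\<close> lets the limit rest on
    continuity of \<open>J\<close> alone, with no appeal to continuity of \<open>B\<close>.\<close>
  have F_eq: "F (X k) = J (X k) *v (X k - X (Suc k))" for k
    by (simp add: X_Suc step_def)
  have "(\<lambda>k. J (X k)) \<longlonglongrightarrow> J L"
    using contJ L by (auto simp: continuous_on_eq_continuous_at intro: isCont_tendsto_compose)
  moreover have "(\<lambda>k. X k - X (Suc k)) \<longlonglongrightarrow> L - L"
    using L by (intro tendsto_diff LIMSEQ_Suc)
  ultimately have "(\<lambda>k. J (X k) *v (X k - X (Suc k))) \<longlonglongrightarrow> J L *v (L - L)"
    by (rule tendsto_matrix_vector_mult)
  then have "(\<lambda>k. F (X k)) \<longlonglongrightarrow> 0" by (simp add: F_eq)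
  moreover have "(\<lambda>k. F (X k)) \<longlonglongrightarrow> F L"
    using has_derivative_continuous[OF deriv] L by (rule isCont_tendsto_compose)
  ultimately have "F L = 0" by (rule LIMSEQ_unique[rotated])
  then show ?thesis by (rule that)
qed

text \<open>A zero is a fixed point of \<open>step\<close>, so \<open>le_step\<close> bounds each of
  two zeros by the other.\<close>

lemma zero_unique:
  assumes "F z = 0" "F w = 0"
  shows "z = w"
  using le_step[of z w] le_step[of w z] assms by (simp add: step_def)

text \<open>With \<open>b = B x *v F x\<close>, the element-wise bounds 0 \<le> \<open>b\<close>
  \<le> \<open>x - z\<close> can be multiplied by \<open>b\<close> and summed.\<close>

lemma step_inner:
  assumes "0 \<le> F x" "F z = 0"
  shows "(norm (B x *v F x))\<^sup>2 \<le> inner (- (B x *v F x)) (z - x)"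
proof -
  let ?b = "B x *v F x"
  have b: "0 \<le> ?b" using step_le[OF assms(1)] by (simp add: step_def)
  have z: "?b \<le> x - z" using le_step[of z x] assms(2) by (simp add: step_def algebra_simps)
  have "inner ?b ?b \<le> inner ?b (x - z)"
    using b z by (auto simp: inner_vec_def less_eq_vec_def intro!: sum_mono mult_left_mono)
  then show ?thesis by (simp add: power2_norm_eq_inner inner_diff_right)
qed

end

lemma I_imp_II:
  assumes C1: "C1 F" and I: "assumption_I F"
  shows "assumption_II F x0"
proof -
  let ?J = "\<lambda>x. jacobian F (at x)"
  have inv: "invertible (?J x)" for x
    using I by (simp add: assumption_I_def DF_def)
  interpret monotone_newton F ?J "\<lambda>x. matrix_inv (?J x)"
  proof
    show "(F has_derivative (*v) (?J x)) (at x)" for x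
      using C1 by (simp add: C1_def flip: jacobian_works)
    show "0 \<le> matrix_inv (?J x) $ i $ j" for x i j
      using I by (simp add: assumption_I_def DF_def less_imp_le)
  qed (use C1 I matrix_inv_both[OF inv] in \<open>auto simp: C1_def assumption_I_def\<close>)
  have pinv: "pinv (?J x) = matrix_inv (?J x)" for x
    using inv by (rule pinv_invertible)
  obtain z where z: "F z = 0"
    using I zero_exists by (auto simp: assumption_I_def)
  \<comment> \<open>The sign of \<open>F x0\<close> is unknown, since the start is arbitrary; every
    iterate from index 1 on is the result of a Newton step.\<close>
  have pos: "0 \<le> F (newton_iter F x0 k)" if "k \<ge> 1" for k
    using that F_step_nonneg by (cases k) (auto simp: step_def DF_def pinv)
  have "F x \<in> range ((*v) (?J x))" for x
    using J_B_apply[of x "F x"] by (metis rangeI)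
  moreover have "1/2 * (norm (newton_dir F x))\<^sup>2 \<le> inner (newton_dir F x) (z - x)"
    if "0 \<le> F x" for x
  proof -
    have "newton_dir F x = - (matrix_inv (?J x) *v F x)"
      by (simp add: newton_dir_def DF_def pinv)
    then have "(norm (newton_dir F x))\<^sup>2 \<le> inner (newton_dir F x) (z - x)"
      using step_inner[OF that z] by simp
    then show ?thesis
      using zero_le_power2[of "norm (newton_dir F x)"] by linarith
  qed
  ultimately show ?thesis
    unfolding assumption_II_def Let_def
    using z zero_unique pos by (intro exI[of _ z]) (auto simp: DF_def)
qed

lemma jacobian_uminus: "jacobian uminus (at x) = (- mat 1 :: real^'p^'p)"
proof -
  have "(uminus has_derivative (\<lambda>v. - v)) (at x)"
    by (auto intro!: derivative_eq_intros)
  then have "frechet_derivative uminus (at x) = (\<lambda>v::real^'p. - v)"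
    by (metis frechet_derivative_at)
  then show ?thesis
    by (simp add: jacobian_def matrix_def vec_eq_iff mat_def axis_def)
qed

lemma uminus_mat_1_apply: "(- mat 1) *v x = - (x :: real^'p)"
  using matrix_vector_mult_diff_rdistrib[of 0 "mat 1" x] by simp

lemma uminus_mat_1_square: "(- mat 1) ** (- mat 1) = (mat 1 :: real^'p^'p)"
  by (simp add: matrix_eq uminus_mat_1_apply flip: matrix_vector_mul_assoc)

lemma C1_uminus: "C1 (uminus :: real^'p \<Rightarrow> real^'p)"
  by (auto simp: C1_def jacobian_uminus intro!: derivative_intros)

text \<open>The Newton direction at \<open>x\<close> is \<open>- x\<close>, which points exactly to
  the only zero 0, so the inequality compares half of a squared norm with the squared norm
  itself.\<close>

lemma II_uminus: "assumption_II (uminus :: real^'p \<Rightarrow> real^'p) x0"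
proof -
  have pinv: "pinv (- mat 1 :: real^'p^'p) = - mat 1"
    by (intro pinv_eq uminus_mat_1_square)
  have "newton_dir uminus x = - x" for x :: "real^'p"
    by (simp add: newton_dir_def DF_def jacobian_uminus pinv uminus_mat_1_apply)
  then show ?thesis
    by (auto simp: assumption_II_def Let_def DF_def jacobian_uminus uminus_mat_1_apply
        power2_norm_eq_inner)
qed

text \<open>The Jacobian is its own inverse and has -1 on the diagonal, which contradicts
  element-wise positivity.\<close>

lemma not_I_uminus: "\<not> assumption_I (uminus :: real^'p \<Rightarrow> real^'p)"
proof
  assume I: "assumption_I (uminus :: real^'p \<Rightarrow> real^'p)"
  let ?A = "- mat 1 :: real^'p^'p"
  have "invertible ?A"
    using uminus_mat_1_square by (auto simp: invertible_def)
  \<comment> \<open>Both sides equal \<open>pinv ?A\<close>.\<close>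
  then have "matrix_inv ?A = ?A"
    using pinv_invertible pinv_eq uminus_mat_1_square by metis
  then have "?A $ i $ i > 0" for i
    using I by (simp add: assumption_I_def DF_def jacobian_uminus)
  then show False by (simp add: mat_def)
qed

theorem theorem5p2:
  shows "(\<forall>(F :: real^'p \<Rightarrow> real^'p) x0. C1 F \<longrightarrow> assumption_I F \<longrightarrow> assumption_II F x0) \<and>
         (\<exists>F :: real^'p \<Rightarrow> real^'p. C1 F \<and> (\<forall>x0. assumption_II F x0) \<and> \<not> assumption_I F)"
  using I_imp_II C1_uminus II_uminus not_I_uminus by blast

end
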